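(* Let $S$ be a set and $M$ a monoid. (i) If $(S,N)$ is a quadratic normalisation for $M$, then $R=\{\,s|t\to\overline{N}(s|t): s,t\in S,\ s|t\ne\overline{N}(s|t)\,\}$ defines a quadratic, reduced, normalising and confluent rewriting system $(S,R)$ presenting $M$. (ii) Conversely, if $(S,R)$ is a quadratic, reduced, normalising and confluent rewriting system presenting $M$, then putting $N(w)=w'$, where $w'$ is the $R$-normal form of $w$, defines a quadratic normalisation $(S,N)$ for $M$. (iii) The correspondences of (i) and (ii) are inverses of one another.
   Context: For a set $S$, $S^*$ is the free monoid of words over $S$, $\|w\|$ is word length, $u|v$ is concatenation, $S^{[2]}$ is the set of length-two words. A normalisation is a pair $(S,N)$ with $N:S^*\to S^*$ such that for all words $u,v,w$: $\|N(w)\|=\|w\|$; $\|w\|=1$ implies $N(w)=w$; $N(u|N(w)|v)=N(u|w|v)$. A word is $N$-normal if $N(w)=w$. It is a normalisation for $M$ if $M$ is presented by generators $S$ and relations $\{w=N(w):w\in S^*\}$. $\overline{N}$ is the restriction of $N$ to $S^{[2]}$; $\overline{N}_i$ applies $\overline{N}$ to the entries in positions $i,i+1$; $\overline{N}_{i_1\cdots i_n}=\overline{N}_{i_n}\circ\cdots\circ\overline{N}_{i_1}$. $(S,N)$ is quadratic if (a) a word is $N$-normal iff each of its length-two factors is, and (b) for every word $w$ there is a finite sequence $u$ of positions with $N(w)=\overline{N}_u(w)$. A rewriting system is a pair $(S,R)$ consisting of a set $S$ and a binary relation $R$ on $S^*$, whose elements $(w,w')$ are written $w\to w'$ and called rules;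 $\to_R$ is the closure of $R$ with respect to the product of $S^*$, that is, the relation $u|w|v\to_R u|w'|v$ for $u,v\in S^*$, $w\to w'$ in $R$; $\to_R^*$ is the reflexive-transitive closure of $\to_R$. A word $w$ is $R$-normal if $w\to_R^*w'$ implies $w'=w$; $w'$ is an $R$-normal form of $w$ if $w\to_R^*w'$ and $w'$ is $R$-normal. $(S,R)$ is: quadratic if $\|w\|=\|w'\|=2$ for every rule $w\to w'$ in $R$; reduced if for every rule $w\to w'$ in $R$, $w'$ is $R$-normal and $w$ is $(R\setminus\{w\to w'\})$-normal; normalising if every word has at least one $R$-normal form; confluent if $w\to_R^*w_1$ and $w\to_R^*w_2$ imply $w_1\to_R^*w'$ and $w_2\to_R^*w'$ for some $w'$ (so in a normalising confluent system each word has exactly one $R$-normal form). $(S,R)$ presents $M$ if $M$ is presented by generators $S$ and relations $w=w'$ for $w\to w'$ in $R$.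
   Formalization: In (iii), that passing from R to N and back returns R is stated only for systems R without trivial rules w → w; with them it fails, e.g. S={s}, R={s|s → s|s} gives N=id and then the empty system. *)

theory Defs
  imports "HOL-Algebra.Group" "HOL-Library.Sublist" "HOL-Library.FuncSet"
begin

section \<open>Monoid presentations\<close>

text \<open>The smallest monoid congruence on the free monoid \<open>lists S\<close> that contains \<open>Rel\<close>.\<close>

inductive_set generated_congruence :: "'a set \<Rightarrow> ('a list \<times> 'a list) set \<Rightarrow> ('a list \<times> 'a list) set"
  for S Rel where
  base: "(w, w') \<in> Rel \<Longrightarrow> (w, w') \<in> generated_congruence S Rel"
| refl: "w \<in> lists S \<Longrightarrow> (w, w) \<in> generated_congruence S Rel"
| sym: "(w, w') \<in> generated_congruence S Rel \<Longrightarrow> (w', w) \<in> generated_congruence S Rel"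
| trans: "(w, w') \<in> generated_congruence S Rel \<Longrightarrow> (w', w'') \<in> generated_congruence S Rel
    \<Longrightarrow> (w, w'') \<in> generated_congruence S Rel"
| append: "(u, u') \<in> generated_congruence S Rel \<Longrightarrow> (v, v') \<in> generated_congruence S Rel
    \<Longrightarrow> (u @ v, u' @ v') \<in> generated_congruence S Rel"

definition presented_monoid :: "'a set \<Rightarrow> ('a list \<times> 'a list) set \<Rightarrow> 'a list set monoid" where
  "presented_monoid S Rel =
    \<lparr>carrier = lists S // generated_congruence S Rel,
     mult = (\<lambda>A B. \<Union>u\<in>A. \<Union>v\<in>B. generated_congruence S Rel `` {u @ v}),
     one = generated_congruence S Rel `` {[]}\<rparr>"

definition presented_by ::
  "('b, 'm) monoid_scheme \<Rightarrow> 'a set \<Rightarrow> ('a list \<times> 'a list) set \<Rightarrow> bool" where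
  "presented_by M S Rel \<longleftrightarrow> presented_monoid S Rel \<cong> M"

section \<open>Normalisations\<close>

text \<open>Maps from words over \<open>S\<close> to words over \<open>S\<close> are taken extensional, so that two of them
  are equal as soon as they agree on \<open>lists S\<close>.\<close>

definition normalisation :: "'a set \<Rightarrow> ('a list \<Rightarrow> 'a list) \<Rightarrow> bool" where
  "normalisation S N \<longleftrightarrow>
    N \<in> lists S \<rightarrow>\<^sub>E lists S \<and>
    (\<forall>w\<in>lists S. length (N w) = length w) \<and>
    (\<forall>w\<in>lists S. length w = 1 \<longrightarrow> N w = w) \<and>
    (\<forall>u\<in>lists S. \<forall>v\<in>lists S. \<forall>w\<in>lists S. N (u @ N w @ v) = N (u @ w @ v))"

definition normalisation_for ::
  "'a set \<Rightarrow> ('a list \<Rightarrow> 'a list) \<Rightarrow> ('b, 'm) monoid_scheme \<Rightarrow> bool" where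
  "normalisation_for S N M \<longleftrightarrow>
    normalisation S N \<and> presented_by M S {(w, N w) | w. w \<in> lists S}"

definition N_normal :: "('a list \<Rightarrow> 'a list) \<Rightarrow> 'a list \<Rightarrow> bool" where
  "N_normal N w \<longleftrightarrow> N w = w"

definition Nbar :: "'a set \<Rightarrow> ('a list \<Rightarrow> 'a list) \<Rightarrow> 'a list \<Rightarrow> 'a list" where
  "Nbar S N = restrict N {w \<in> lists S. length w = 2}"

text \<open>Positions are counted from 1; position \<open>i\<close> is meaningful for \<open>w\<close> if
  \<open>1 \<le> i < length w\<close>.\<close>

definition Nbar_at :: "'a set \<Rightarrow> ('a list \<Rightarrow> 'a list) \<Rightarrow> nat \<Rightarrow> 'a list \<Rightarrow> 'a list" where
  "Nbar_at S N i w = take (i - 1) w @ Nbar S N [w ! (i - 1), w ! i] @ drop (i + 1) w"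

text \<open>\<open>fold\<close> applies the leftmost position of the sequence first.\<close>

definition quadratic_normalisation :: "'a set \<Rightarrow> ('a list \<Rightarrow> 'a list) \<Rightarrow> bool" where
  "quadratic_normalisation S N \<longleftrightarrow>
    normalisation S N \<and>
    (\<forall>w\<in>lists S. N_normal N w \<longleftrightarrow> (\<forall>x. sublist x w \<and> length x = 2 \<longrightarrow> N_normal N x)) \<and>
    (\<forall>w\<in>lists S. \<exists>is. set is \<subseteq> {1..<length w} \<and> N w = fold (Nbar_at S N) is w)"

section \<open>Rewriting systems\<close>

definition rewriting_system :: "'a set \<Rightarrow> ('a list \<times> 'a list) set \<Rightarrow> bool" where
  "rewriting_system S R \<longleftrightarrow> R \<subseteq> lists S \<times> lists S"

definition rewrite_step :: "'a set \<Rightarrow> ('a list \<times> 'a list) set \<Rightarrow> ('a list \<times> 'a list) set" where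
  "rewrite_step S R =
    {(u @ w @ v, u @ w' @ v) | u v w w'. u \<in> lists S \<and> v \<in> lists S \<and> (w, w') \<in> R}"

text \<open>A trivial rule \<open>w \<rightarrow> w\<close> does not prevent \<open>w\<close> from being normal in the following sense.
  In particular, the notion of a reduced system below does not exclude trivial rules; where
  they have to be excluded, this is expressed by \<open>irrefl R\<close>.\<close>

definition R_normal :: "'a set \<Rightarrow> ('a list \<times> 'a list) set \<Rightarrow> 'a list \<Rightarrow> bool" where
  "R_normal S R w \<longleftrightarrow> (\<forall>w'. (w, w') \<in> (rewrite_step S R)\<^sup>* \<longrightarrow> w' = w)"

definition is_R_normal_form ::
  "'a set \<Rightarrow> ('a list \<times> 'a list) set \<Rightarrow> 'a list \<Rightarrow> 'a list \<Rightarrow> bool" where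
  "is_R_normal_form S R w w' \<longleftrightarrow> (w, w') \<in> (rewrite_step S R)\<^sup>* \<and> R_normal S R w'"

definition quadratic_rules :: "('a list \<times> 'a list) set \<Rightarrow> bool" where
  "quadratic_rules R \<longleftrightarrow> (\<forall>(w, w')\<in>R. length w = 2 \<and> length w' = 2)"

definition reduced :: "'a set \<Rightarrow> ('a list \<times> 'a list) set \<Rightarrow> bool" where
  "reduced S R \<longleftrightarrow> (\<forall>(w, w')\<in>R. R_normal S R w' \<and> R_normal S (R - {(w, w')}) w)"

definition normalising :: "'a set \<Rightarrow> ('a list \<times> 'a list) set \<Rightarrow> bool" where
  "normalising S R \<longleftrightarrow> (\<forall>w\<in>lists S. \<exists>w'. is_R_normal_form S R w w')"

definition confluent :: "'a set \<Rightarrow> ('a list \<times> 'a list) set \<Rightarrow> bool" where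
  "confluent S R \<longleftrightarrow>
    (\<forall>w\<in>lists S. \<forall>w1 w2.
      (w, w1) \<in> (rewrite_step S R)\<^sup>* \<and> (w, w2) \<in> (rewrite_step S R)\<^sup>* \<longrightarrow>
      (\<exists>w'. (w1, w') \<in> (rewrite_step S R)\<^sup>* \<and> (w2, w') \<in> (rewrite_step S R)\<^sup>*))"

section \<open>The two correspondences\<close>

definition rewriting_of :: "'a set \<Rightarrow> ('a list \<Rightarrow> 'a list) \<Rightarrow> ('a list \<times> 'a list) set" where
  "rewriting_of S N =
    {([s, t], Nbar S N [s, t]) | s t. s \<in> S \<and> t \<in> S \<and> [s, t] \<noteq> Nbar S N [s, t]}"

definition normalisation_of :: "'a set \<Rightarrow> ('a list \<times> 'a list) set \<Rightarrow> 'a list \<Rightarrow> 'a list" where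
  "normalisation_of S R = (\<lambda>w\<in>lists S. THE w'. is_R_normal_form S R w w')"

end

theory Submission
  imports Defs
begin

text \<open>A word is \<open>N\<close>-normal iff all its factors of length two are, and these are exactly
  the words without a factor that is the left-hand side of a nontrivial quadratic rule. Hence
  \<open>N\<close>-normal and \<open>R\<close>-normal words agree under both correspondences. Applying \<open>Nbar\<close> at a
  position is either trivial or a rewriting step, and, \<open>R\<close> being reduced, every rewriting step
  is of this form; so \<open>N w\<close> is the unique \<open>R\<close>-normal form of \<open>w\<close> in both directions.\<close>

section \<open>Presentations\<close>

text \<open>The target is itself a congruence, so containing the generators is enough: each closure
  rule of the induction is available in it.\<close>

lemma generated_congruence_subset:
  assumes "Rel \<subseteq> generated_congruence S Rel'"
  shows "generated_congruence S Rel \<subseteq> generated_congruence S Rel'"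
proof (rule subrelI)
  fix w w' assume "(w, w') \<in> generated_congruence S Rel"
  then show "(w, w') \<in> generated_congruence S Rel'"
    by induction (use assms in \<open>auto intro: generated_congruence.intros\<close>)
qed

text \<open>Relations that follow from each other generate the same congruence, so the presented
  monoids are equal and not merely isomorphic. This moves presentations between rules and the
  relations \<open>w = N w\<close>.\<close>

lemma presented_by_cong:
  assumes "Rel \<subseteq> generated_congruence S Rel'" "Rel' \<subseteq> generated_congruence S Rel"
  shows "presented_by M S Rel \<longleftrightarrow> presented_by M S Rel'"
proof -
  have "generated_congruence S Rel = generated_congruence S Rel'"
    using assms by (simp add: generated_congruence_subset subset_antisym)
  then show ?thesis
    by (simp add: presented_by_def presented_monoid_def)
qed

section \<open>Rewriting\<close>

lemma rewrite_stepI: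
  assumes "u \<in> lists S" "v \<in> lists S" "(w, w') \<in> R"
  shows "(u @ w @ v, u @ w' @ v) \<in> rewrite_step S R"
  using assms unfolding rewrite_step_def by blast

lemma rewrite_stepE:
  assumes "(x, y) \<in> rewrite_step S R"
  obtains u v w w' where "u \<in> lists S" "v \<in> lists S" "(w, w') \<in> R"
    "x = u @ w @ v" "y = u @ w' @ v"
  using assms unfolding rewrite_step_def by blast

lemma rewrite_step_append:
  assumes "(x, y) \<in> rewrite_step S R" "u \<in> lists S" "v \<in> lists S"
  shows "(u @ x @ v, u @ y @ v) \<in> rewrite_step S R"
proof -
  obtain a b w w' where *: "a \<in> lists S" "b \<in> lists S" "(w, w') \<in> R"
    "x = a @ w @ b" "y = a @ w' @ b"
    using assms(1) by (rule rewrite_stepE)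
  then have "((u @ a) @ w @ (b @ v), (u @ a) @ w' @ (b @ v)) \<in> rewrite_step S R"
    using assms by (intro rewrite_stepI) auto
  then show ?thesis
    using * by simp
qed

lemma rewrite_steps_append:
  assumes "(x, y) \<in> (rewrite_step S R)\<^sup>*" "u \<in> lists S" "v \<in> lists S"
  shows "(u @ x @ v, u @ y @ v) \<in> (rewrite_step S R)\<^sup>*"
  using assms
  by (induction rule: rtrancl_induct) (auto intro: rtrancl_into_rtrancl rewrite_step_append)

lemma rewrite_step_lists:
  assumes "(x, y) \<in> rewrite_step S R" "rewriting_system S R"
  shows "y \<in> lists S"
  using assms unfolding rewriting_system_def
  by (elim rewrite_stepE) (simp, blast)

lemma rewrite_steps_lists:
  assumes "(x, y) \<in> (rewrite_step S R)\<^sup>*" "rewriting_system S R" "x \<in> lists S"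
  shows "y \<in> lists S"
  using assms by (induction rule: rtrancl_induct) (blast dest: rewrite_step_lists)+

lemma rewrite_steps_length:
  assumes "(x, y) \<in> (rewrite_step S R)\<^sup>*" "quadratic_rules R"
  shows "length y = length x"
  using assms
  by (induction rule: rtrancl_induct) (auto simp: quadratic_rules_def elim!: rewrite_stepE)

text \<open>A step replaces a factor by a related one inside an unchanged context. The hypothesis on
  \<open>x\<close> serves the derivation of length zero, as the congruence is reflexive only on
  \<open>lists S\<close>.\<close>

lemma rewrite_steps_congruent:
  assumes "(x, y) \<in> (rewrite_step S R)\<^sup>*" "x \<in> lists S"
  shows "(x, y) \<in> generated_congruence S R"
  using assms
proof (induction rule: rtrancl_induct)
  case (step y z)
  have "(y, z) \<in> generated_congruence S R"
    using step.hyps(2)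
    by (auto elim!: rewrite_stepE intro!: generated_congruence.append
        intro: generated_congruence.base generated_congruence.refl)
  then show ?case
    using step by (blast intro: generated_congruence.trans)
qed (rule generated_congruence.refl)

section \<open>Normal words and uniqueness of normal forms\<close>

lemma R_normal_iff_step:
  "R_normal S R w \<longleftrightarrow> (\<forall>w'. (w, w') \<in> rewrite_step S R \<longrightarrow> w' = w)"
proof
  assume step: "\<forall>w'. (w, w') \<in> rewrite_step S R \<longrightarrow> w' = w"
  have "w' = w" if "(w, w') \<in> (rewrite_step S R)\<^sup>*" for w'
    using that by (induction rule: rtrancl_induct) (use step in auto)
  then show "R_normal S R w"
    by (simp add: R_normal_def)
qed (auto simp: R_normal_def)

text \<open>A step acts on one factor, and cancelling its context shows that it fixes the word only
  if the rule is trivial. Normality thus becomes a local condition, comparable with condition (a) of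
  a quadratic normalisation.\<close>

lemma R_normal_iff_sublist:
  assumes "w \<in> lists S"
  shows "R_normal S R w \<longleftrightarrow> (\<forall>x x'. sublist x w \<and> (x, x') \<in> R \<longrightarrow> x' = x)"
proof
  assume normal: "R_normal S R w"
  show "\<forall>x x'. sublist x w \<and> (x, x') \<in> R \<longrightarrow> x' = x"
  proof (intro allI impI, elim conjE)
    fix x x' assume "sublist x w" "(x, x') \<in> R"
    then obtain u v where w: "w = u @ x @ v"
      by (auto simp: sublist_def)
    then have "(w, u @ x' @ v) \<in> rewrite_step S R"
      using assms \<open>(x, x') \<in> R\<close> by (auto intro: rewrite_stepI)
    then show "x' = x"
      using normal w by (auto simp: R_normal_iff_step)
  qed
next
  assume trivial: "\<forall>x x'. sublist x w \<and> (x, x') \<in> R \<longrightarrow> x' = x"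
  have "w' = w" if "(w, w') \<in> rewrite_step S R" for w'
  proof -
    obtain u v x x' where "(x, x') \<in> R" "w = u @ x @ v" "w' = u @ x' @ v"
      using \<open>(w, w') \<in> rewrite_step S R\<close> by (rule rewrite_stepE)
    moreover from this have "x' = x"
      using trivial by blast
    ultimately show ?thesis
      by simp
  qed
  then show "R_normal S R w"
    by (simp add: R_normal_iff_step)
qed

lemma sublist_same_length:
  "sublist x y \<Longrightarrow> length x = length y \<Longrightarrow> x = y"
  by (auto simp: sublist_def)

text \<open>The left-hand side of a quadratic rule fits into a word of length two only as the whole
  word.\<close>

lemma R_normal_length_2:
  assumes "quadratic_rules R" "w \<in> lists S" "length w = 2"
  shows "R_normal S R w \<longleftrightarrow> (\<forall>w'. (w, w') \<in> R \<longrightarrow> w' = w)"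
proof -
  have "x = w" if "sublist x w" "(x, x') \<in> R" for x x'
    using that assms by (intro sublist_same_length) (auto simp: quadratic_rules_def)
  then show ?thesis
    using assms(2) by (auto simp: R_normal_iff_sublist)
qed

text \<open>Confluence gives two normal forms a common reduct, and a normal word has no reduct but
  itself.\<close>

lemma R_normal_form_unique:
  assumes "confluent S R" "w \<in> lists S" "is_R_normal_form S R w w1" "is_R_normal_form S R w w2"
  shows "w1 = w2"
proof -
  obtain w' where "(w1, w') \<in> (rewrite_step S R)\<^sup>*" "(w2, w') \<in> (rewrite_step S R)\<^sup>*"
    using assms unfolding confluent_def is_R_normal_form_def by blast
  then show ?thesis
    using assms(3,4) unfolding is_R_normal_form_def R_normal_def by blast
qed

lemma normalisation_of_eq:
  assumes "confluent S R" "w \<in> lists S" "is_R_normal_form S R w w'"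
  shows "normalisation_of S R w = w'"
proof -
  have "(THE w'. is_R_normal_form S R w w') = w'"
    using assms(3) R_normal_form_unique[OF assms(1,2) _ assms(3)] by (rule the_equality)
  then show ?thesis
    using assms(2) by (simp add: normalisation_of_def)
qed

section \<open>From normalisations to rewriting systems\<close>

lemma normalisation_in_lists:
  "normalisation S N \<Longrightarrow> w \<in> lists S \<Longrightarrow> N w \<in> lists S"
  unfolding normalisation_def by blast

lemma normalisation_length:
  "normalisation S N \<Longrightarrow> w \<in> lists S \<Longrightarrow> length (N w) = length w"
  unfolding normalisation_def by blast

lemma normalisation_inner:
  assumes "normalisation S N" "u \<in> lists S" "v \<in> lists S" "w \<in> lists S"
  shows "N (u @ N w @ v) = N (u @ w @ v)"
  using assms unfolding normalisation_def by blast

lemma normalisation_idem: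
  assumes "normalisation S N" "w \<in> lists S"
  shows "N (N w) = N w"
  using normalisation_inner[OF assms(1), of "[]" "[]" w] assms(2) by simp

text \<open>On words of length two over \<open>S\<close>, \<open>Nbar\<close> agrees with
  \<open>N\<close>; later arguments can therefore avoid both letters and
  \<open>Nbar\<close>.\<close>

lemma rewriting_of_iff:
  "(x, y) \<in> rewriting_of S N \<longleftrightarrow> x \<in> lists S \<and> length x = 2 \<and> y = N x \<and> x \<noteq> y"
proof -
  have "(\<exists>s t. x = [s, t] \<and> s \<in> S \<and> t \<in> S) \<longleftrightarrow> x \<in> lists S \<and> length x = 2"
    by (auto simp: numeral_2_eq_2 length_Suc_conv)
  moreover have "Nbar S N [s, t] = N [s, t]" if "s \<in> S" "t \<in> S" for s t
    using that by (simp add: Nbar_def)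
  ultimately show ?thesis
    unfolding rewriting_of_def by auto
qed

lemma rewriting_system_rewriting_of:
  assumes "normalisation S N"
  shows "rewriting_system S (rewriting_of S N)"
proof -
  have "x \<in> lists S \<and> y \<in> lists S" if "(x, y) \<in> rewriting_of S N" for x y
    using that normalisation_in_lists[OF assms] unfolding rewriting_of_iff by simp
  then show ?thesis
    unfolding rewriting_system_def by (simp add: subset_iff)
qed

lemma quadratic_rules_rewriting_of:
  assumes "normalisation S N"
  shows "quadratic_rules (rewriting_of S N)"
  unfolding quadratic_rules_def by (auto simp: rewriting_of_iff normalisation_length[OF assms])

text \<open>Right-hand sides are normal because \<open>N\<close> is idempotent. Since the rules form
  the graph of a partial function, deleting the rule for \<open>x\<close> leaves none with left-hand
  side \<open>x\<close>.\<close>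

lemma reduced_rewriting_of:
  assumes "normalisation S N"
  shows "reduced S (rewriting_of S N)"
proof -
  let ?R = "rewriting_of S N"
  have "R_normal S ?R y \<and> R_normal S (?R - {(x, y)}) x" if "(x, y) \<in> ?R" for x y
  proof -
    have x: "x \<in> lists S" "length x = 2" and y: "y = N x"
      using that by (auto simp: rewriting_of_iff)
    have quad: "quadratic_rules ?R"
      by (rule quadratic_rules_rewriting_of[OF assms])
    then have quad': "quadratic_rules (?R - {(x, y)})"
      by (auto simp: quadratic_rules_def)
    have "y \<in> lists S" "length y = 2" "N y = y"
      using x y assms by (simp_all add: normalisation_in_lists normalisation_length
          normalisation_idem)
    then have "R_normal S ?R y"
      by (subst R_normal_length_2[OF quad]) (auto simp: rewriting_of_iff)
    moreover have "R_normal S (?R - {(x, y)}) x"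
      using x y by (subst R_normal_length_2[OF quad']) (auto simp: rewriting_of_iff)
    ultimately show ?thesis ..
  qed
  then show ?thesis
    unfolding reduced_def by blast
qed

section \<open>Normalising at a position as rewriting\<close>

lemma factor_at:
  assumes "i \<in> {1..<length w}"
  shows "w = take (i - 1) w @ [w ! (i - 1), w ! i] @ drop (i + 1) w"
proof -
  \<comment> \<open>Positions start at 1 and list indices at 0: the factor at position
    \<open>i\<close> has the indices \<open>j\<close> and \<open>Suc j\<close>.\<close>
  obtain j where "i = Suc j"
    using assms by (cases i) auto
  then show ?thesis
    using assms by (simp add: Cons_nth_drop_Suc)
qed

lemma Nbar_at_append:
  assumes "w \<in> lists S" "length w = 2"
  shows "Nbar_at S N (Suc (length u)) (u @ w @ v) = u @ N w @ v"
proof -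
  obtain s t where "w = [s, t]"
    using assms(2) by (auto simp: numeral_2_eq_2 length_Suc_conv)
  then show ?thesis
    using assms(1) by (simp add: Nbar_at_def Nbar_def nth_append)
qed

text \<open>The reflexive closure is essential: if \<open>N\<close> fixes the factor at position
  \<open>i\<close>, there is no rule for it and the derivation has length zero.\<close>

lemma Nbar_at_rewrite:
  assumes "w \<in> lists S" "i \<in> {1..<length w}"
  shows "(w, Nbar_at S N i w) \<in> (rewrite_step S (rewriting_of S N))\<^sup>*"
proof -
  define u x v where "u = take (i - 1) w" and "x = [w ! (i - 1), w ! i]" and "v = drop (i + 1) w"
  have w: "w = u @ x @ v"
    unfolding u_def x_def v_def using assms(2) by (rule factor_at)
  then have S: "u \<in> lists S" "x \<in> lists S" "v \<in> lists S"
    using assms(1) by auto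
  have "length x = 2" "i = Suc (length u)"
    using assms(2) by (auto simp: u_def x_def)
  then have at: "Nbar_at S N i w = u @ N x @ v"
    using Nbar_at_append[OF S(2), of N u v] w by simp
  show ?thesis
  proof (cases "N x = x")
    case True
    then show ?thesis
      using at w by simp
  next
    case False
    then have "(x, N x) \<in> rewriting_of S N"
      using S \<open>length x = 2\<close> by (auto simp: rewriting_of_iff)
    then have "(u @ x @ v, u @ N x @ v) \<in> rewrite_step S (rewriting_of S N)"
      by (rule rewrite_stepI[OF S(1,3)])
    then show ?thesis
      using at w by auto
  qed
qed

text \<open>Each application changes the word, so the induction generalises over \<open>w\<close>.
  The positions stay meaningful because rewriting preserves length.\<close>

lemma fold_Nbar_at_rewrite:
  assumes "normalisation S N" "w \<in> lists S" "set is \<subseteq> {1..<length w}"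
  shows "(w, fold (Nbar_at S N) is w) \<in> (rewrite_step S (rewriting_of S N))\<^sup>*"
  using assms(2,3)
proof (induction "is" arbitrary: w)
  case (Cons i "is")
  have step: "(w, Nbar_at S N i w) \<in> (rewrite_step S (rewriting_of S N))\<^sup>*"
    using Cons.prems by (intro Nbar_at_rewrite) auto
  have "Nbar_at S N i w \<in> lists S"
    using step rewriting_system_rewriting_of[OF assms(1)] Cons.prems(1)
    by (rule rewrite_steps_lists)
  moreover have "length (Nbar_at S N i w) = length w"
    using step quadratic_rules_rewriting_of[OF assms(1)] by (rule rewrite_steps_length)
  ultimately have "(Nbar_at S N i w, fold (Nbar_at S N) is (Nbar_at S N i w))
      \<in> (rewrite_step S (rewriting_of S N))\<^sup>*"
    using Cons.prems(2) by (intro Cons.IH) auto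
  then show ?case
    using step by simp
qed simp

text \<open>Both notions test the factors of length two: the left one because rules act only there,
  the right one by condition (a).\<close>

lemma R_normal_rewriting_of:
  assumes "quadratic_normalisation S N" "w \<in> lists S"
  shows "R_normal S (rewriting_of S N) w \<longleftrightarrow> N_normal N w"
proof -
  have "x \<in> lists S" if "sublist x w" for x
    using that assms(2) by (auto simp: sublist_def)
  then have "R_normal S (rewriting_of S N) w \<longleftrightarrow>
      (\<forall>x. sublist x w \<and> length x = 2 \<longrightarrow> N_normal N x)"
    using R_normal_iff_sublist[OF assms(2), of "rewriting_of S N"]
    unfolding rewriting_of_iff N_normal_def by metis
  then show ?thesis
    using assms unfolding quadratic_normalisation_def by blast
qed

text \<open>Condition (b) supplies the derivation from \<open>w\<close> to \<open>N w\<close>;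
  idempotence makes \<open>N w\<close> normal.\<close>

lemma is_R_normal_form_rewriting_of:
  assumes "quadratic_normalisation S N" "w \<in> lists S"
  shows "is_R_normal_form S (rewriting_of S N) w (N w)"
proof -
  have N: "normalisation S N"
    using assms(1) by (simp add: quadratic_normalisation_def)
  obtain "is" where "set is \<subseteq> {1..<length w}" "N w = fold (Nbar_at S N) is w"
    using assms unfolding quadratic_normalisation_def by blast
  then have "(w, N w) \<in> (rewrite_step S (rewriting_of S N))\<^sup>*"
    using fold_Nbar_at_rewrite[OF N assms(2)] by simp
  moreover have "R_normal S (rewriting_of S N) (N w)"
    by (simp add: R_normal_rewriting_of[OF assms(1) normalisation_in_lists[OF N assms(2)]]
        N_normal_def normalisation_idem[OF N assms(2)])
  ultimately show ?thesis
    by (simp add: is_R_normal_form_def)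
qed

lemma normalising_rewriting_of:
  "quadratic_normalisation S N \<Longrightarrow> normalising S (rewriting_of S N)"
  unfolding normalising_def using is_R_normal_form_rewriting_of by blast

text \<open>The axiom \<open>N (u @ N w @ v) = N (u @ w @ v)\<close> says exactly that a single step
  does not change the value of \<open>N\<close>.\<close>

lemma rewrite_steps_normalisation_eq:
  assumes "normalisation S N" "(x, y) \<in> (rewrite_step S (rewriting_of S N))\<^sup>*"
  shows "N y = N x"
  using assms(2)
proof (induction rule: rtrancl_induct)
  case (step y z)
  have "N z = N y"
    using step.hyps(2)
    by (rule rewrite_stepE) (auto simp: rewriting_of_iff normalisation_inner[OF assms(1)])
  then show ?case
    using step.IH by simp
qed simp

lemma confluent_rewriting_of:
  assumes "quadratic_normalisation S N"
  shows "confluent S (rewriting_of S N)"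
proof -
  let ?R = "rewriting_of S N"
  have N: "normalisation S N"
    using assms by (simp add: quadratic_normalisation_def)
  \<comment> \<open>\<open>N w\<close> is the common reduct for confluence: every reduct
    \<open>w'\<close> of \<open>w\<close> rewrites to \<open>N w'\<close>, which equals
    \<open>N w\<close> by invariance.\<close>
  have "(w', N w) \<in> (rewrite_step S ?R)\<^sup>*"
    if "w \<in> lists S" "(w, w') \<in> (rewrite_step S ?R)\<^sup>*" for w w'
  proof -
    have "w' \<in> lists S"
      using that(2) rewriting_system_rewriting_of[OF N] that(1) by (rule rewrite_steps_lists)
    then have "(w', N w') \<in> (rewrite_step S ?R)\<^sup>*"
      using is_R_normal_form_rewriting_of[OF assms] by (simp add: is_R_normal_form_def)
    then show ?thesis
      using rewrite_steps_normalisation_eq[OF N that(2)] by simp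
  qed
  then show ?thesis
    unfolding confluent_def by blast
qed

text \<open>Every rule is one of the relations \<open>w = N w\<close>. Conversely, such a relation
  follows from the rules along a derivation from \<open>w\<close> to \<open>N w\<close>.\<close>

lemma presented_by_rewriting_of:
  assumes "quadratic_normalisation S N"
  shows "presented_by M S (rewriting_of S N) \<longleftrightarrow> presented_by M S {(w, N w) | w. w \<in> lists S}"
proof (rule presented_by_cong)
  show "rewriting_of S N \<subseteq> generated_congruence S {(w, N w) | w. w \<in> lists S}"
    by (auto simp: rewriting_of_iff
        intro!: generated_congruence.base)
  show "{(w, N w) | w. w \<in> lists S} \<subseteq> generated_congruence S (rewriting_of S N)"
    using is_R_normal_form_rewriting_of[OF assms]
    by (auto simp: is_R_normal_form_def
        intro!: rewrite_steps_congruent)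
qed

lemma normalisation_of_rewriting_of:
  assumes "quadratic_normalisation S N"
  shows "normalisation_of S (rewriting_of S N) = N"
proof
  fix w
  \<comment> \<open>Off \<open>lists S\<close> both maps take the value \<open>undefined\<close>,
    which yields equality of functions and not only of their restrictions.\<close>
  have "N \<in> extensional (lists S)"
    using assms by (auto simp: quadratic_normalisation_def normalisation_def PiE_def)
  then show "normalisation_of S (rewriting_of S N) w = N w"
    using normalisation_of_eq[OF confluent_rewriting_of[OF assms] _
        is_R_normal_form_rewriting_of[OF assms]]
    by (cases "w \<in> lists S") (simp_all add: normalisation_of_def extensional_def)
qed

section \<open>From rewriting systems to normalisations\<close>

lemma is_R_normal_form_normalisation_of:
  assumes "normalising S R" "confluent S R" "w \<in> lists S"
  shows "is_R_normal_form S R w (normalisation_of S R w)"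
proof -
  obtain w' where "is_R_normal_form S R w w'"
    using assms(1,3) unfolding normalising_def by blast
  then show ?thesis
    using normalisation_of_eq[OF assms(2,3)] by simp
qed

lemma normalisation_normalisation_of:
  assumes "rewriting_system S R" "quadratic_rules R" "normalising S R" "confluent S R"
  shows "normalisation S (normalisation_of S R)"
proof -
  let ?N = "normalisation_of S R"
  have nf: "is_R_normal_form S R w (?N w)" if "w \<in> lists S" for w
    using assms(3,4) that by (rule is_R_normal_form_normalisation_of)
  then have steps: "(w, ?N w) \<in> (rewrite_step S R)\<^sup>*" if "w \<in> lists S" for w
    using that by (simp add: is_R_normal_form_def)
  have S: "?N w \<in> lists S" if "w \<in> lists S" for w
    using steps[OF that] assms(1) that by (rule rewrite_steps_lists)
  have length: "length (?N w) = length w" if "w \<in> lists S" for w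
    using steps[OF that] assms(2) by (rule rewrite_steps_length)
  have single: "?N w = w" if w: "w \<in> lists S" "length w = 1" for w
  proof -
    \<comment> \<open>Left-hand sides have length two and do not fit into a single letter.\<close>
    have "\<not> sublist x w" if "(x, x') \<in> R" for x x'
      using that assms(2) w(2) by (auto simp: quadratic_rules_def dest!: sublist_length_le)
    then have "R_normal S R w"
      using R_normal_iff_sublist[OF w(1)] by blast
    then show ?thesis
      using steps[OF w(1)] by (simp add: R_normal_def)
  qed
  have inner: "?N (u @ ?N w @ v) = ?N (u @ w @ v)"
    if u: "u \<in> lists S" and v: "v \<in> lists S" and w: "w \<in> lists S" for u v w
  proof -
    have "(u @ w @ v, u @ ?N w @ v) \<in> (rewrite_step S R)\<^sup>*"
      using steps[OF w] u v by (rule rewrite_steps_append)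
    \<comment> \<open>Prefixing the derivation from \<open>u @ w @ v\<close> to
      \<open>u @ ?N w @ v\<close> makes this a normal form of \<open>u @ w @ v\<close> as well;
      uniqueness then gives the axiom.\<close>
    moreover have "is_R_normal_form S R (u @ ?N w @ v) (?N (u @ ?N w @ v))"
      using u v S[OF w] by (intro nf) simp
    ultimately have "is_R_normal_form S R (u @ w @ v) (?N (u @ ?N w @ v))"
      by (auto simp: is_R_normal_form_def)
    then show ?thesis
      using normalisation_of_eq[OF assms(4)] u v w by simp
  qed
  have "?N \<in> lists S \<rightarrow>\<^sub>E lists S"
    using S by (auto simp: normalisation_of_def)
  then show ?thesis
    unfolding normalisation_def using length single inner by blast
qed

lemma N_normal_normalisation_of:
  assumes "normalising S R" "confluent S R" "w \<in> lists S"
  shows "N_normal (normalisation_of S R) w \<longleftrightarrow> R_normal S R w"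
  using is_R_normal_form_normalisation_of[OF assms]
  by (auto simp: is_R_normal_form_def R_normal_def N_normal_def)

text \<open>Reducedness makes \<open>y\<close> normal, so a single step already reaches the normal
  form of \<open>x\<close>. In particular a left-hand side determines its rule.\<close>

lemma rule_normalisation_of:
  assumes "rewriting_system S R" "reduced S R" "confluent S R" "(x, y) \<in> R"
  shows "y = normalisation_of S R x"
proof -
  have "x \<in> lists S" "R_normal S R y"
    using assms unfolding rewriting_system_def reduced_def by blast+
  moreover have "(x, y) \<in> rewrite_step S R"
    using rewrite_stepI[of "[]" S "[]" x y R] assms(4) by simp
  ultimately show ?thesis
    using normalisation_of_eq[OF assms(3), of x y] by (simp add: is_R_normal_form_def r_into_rtrancl)
qed

text \<open>Replacing the factor \<open>x\<close> behind the prefix \<open>u\<close> by its rule is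
  the same as applying \<open>Nbar\<close> at position \<open>Suc (length u)\<close>, since the
  right-hand side is the normal form of \<open>x\<close>.\<close>

lemma rewrite_steps_fold_Nbar_at:
  assumes "rewriting_system S R" "quadratic_rules R" "reduced S R" "confluent S R"
    and "(w, w') \<in> (rewrite_step S R)\<^sup>*"
  shows "\<exists>is. set is \<subseteq> {1..<length w} \<and> w' = fold (Nbar_at S (normalisation_of S R)) is w"
  using assms(5)
proof (induction rule: rtrancl_induct)
  case base
  show ?case
    by (rule exI[of _ "[]"]) simp
next
  case (step y z)
  obtain "is" where "is": "set is \<subseteq> {1..<length w}"
    "y = fold (Nbar_at S (normalisation_of S R)) is w"
    using step.IH by blast
  obtain u v x x' where yz: "(x, x') \<in> R" "y = u @ x @ v" "z = u @ x' @ v"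
    using step.hyps(2) by (rule rewrite_stepE)
  have x: "x \<in> lists S" "length x = 2"
    using yz(1) assms(1,2) by (auto simp: rewriting_system_def quadratic_rules_def)
  have "Nbar_at S (normalisation_of S R) (Suc (length u)) y = z"
    using Nbar_at_append[OF x] rule_normalisation_of[OF assms(1,3,4) yz(1)] yz by simp
  \<comment> \<open>The bound refers to the initial word \<open>w\<close>, which has the same length
    as \<open>y\<close>.\<close>
  moreover have "Suc (length u) \<in> {1..<length w}"
    using rewrite_steps_length[OF step.hyps(1) assms(2)] yz(2) x(2) by simp
  ultimately show ?case
    using "is" by (intro exI[of _ "is @ [Suc (length u)]"]) auto
qed

text \<open>For (a), both sides say that no factor is the left-hand side of a nontrivial rule, and
  left-hand sides have length two. For (b), a derivation to the normal form is read as a sequence of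
  positions.\<close>

lemma quadratic_normalisation_normalisation_of:
  assumes "rewriting_system S R" "quadratic_rules R" "reduced S R" "normalising S R" "confluent S R"
  shows "quadratic_normalisation S (normalisation_of S R)"
proof -
  let ?N = "normalisation_of S R"
  have "N_normal ?N w \<longleftrightarrow> (\<forall>x. sublist x w \<and> length x = 2 \<longrightarrow> N_normal ?N x)"
    if w: "w \<in> lists S" for w
  proof -
    have "N_normal ?N x \<longleftrightarrow> (\<forall>x'. (x, x') \<in> R \<longrightarrow> x' = x)" if "sublist x w" "length x = 2" for x
    proof -
      have "x \<in> lists S"
        using that(1) w by (auto simp: sublist_def)
      then show ?thesis
        using N_normal_normalisation_of[OF assms(4,5)] R_normal_length_2[OF assms(2)] that(2)
        by blast
    qed
    moreover have "length x = 2" if "(x, x') \<in> R" for x x'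
      using that assms(2) by (auto simp: quadratic_rules_def)
    ultimately show ?thesis
      unfolding N_normal_normalisation_of[OF assms(4,5) w] R_normal_iff_sublist[OF w] by blast
  qed
  moreover have "\<exists>is. set is \<subseteq> {1..<length w} \<and> ?N w = fold (Nbar_at S ?N) is w"
    if "w \<in> lists S" for w
    using is_R_normal_form_normalisation_of[OF assms(4,5) that]
    by (intro rewrite_steps_fold_Nbar_at[OF assms(1-3,5)]) (simp add: is_R_normal_form_def)
  ultimately show ?thesis
    unfolding quadratic_normalisation_def
    using normalisation_normalisation_of[OF assms(1,2,4,5)] by blast
qed

lemma presented_by_normalisation_of:
  assumes "rewriting_system S R" "reduced S R" "normalising S R" "confluent S R"
  shows "presented_by M S {(w, normalisation_of S R w) | w. w \<in> lists S} \<longleftrightarrow> presented_by M S R"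
proof (rule presented_by_cong)
  show "{(w, normalisation_of S R w) | w. w \<in> lists S} \<subseteq> generated_congruence S R"
    using is_R_normal_form_normalisation_of[OF assms(3,4)]
    by (auto simp: is_R_normal_form_def
        intro!: rewrite_steps_congruent)
  show "R \<subseteq> generated_congruence S {(w, normalisation_of S R w) | w. w \<in> lists S}"
    using assms(1) rule_normalisation_of[OF assms(1,2,4)]
    by (auto simp: rewriting_system_def
        intro!: generated_congruence.base)
qed

text \<open>\<open>rewriting_of\<close> never produces trivial rules, while \<open>reduced\<close>
  admits them; recovering \<open>R\<close> exactly therefore requires
  \<open>irrefl R\<close>.\<close>

lemma rewriting_of_normalisation_of:
  assumes "rewriting_system S R" "quadratic_rules R" "reduced S R" "normalising S R"
    "confluent S R" "irrefl R"
  shows "rewriting_of S (normalisation_of S R) = R"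
proof -
  note rule = rule_normalisation_of[OF assms(1,3,5)]
  have "(x, y) \<in> R" if "(x, y) \<in> rewriting_of S (normalisation_of S R)" for x y
  proof -
    have x: "x \<in> lists S" "length x = 2" and y: "y = normalisation_of S R x" "x \<noteq> y"
      using that unfolding rewriting_of_iff by blast+
    \<comment> \<open>A word of length two moved by the normal form map is the left-hand side of
      some rule of \<open>R\<close>, whose right-hand side must then be \<open>y\<close>.\<close>
    have "\<not> R_normal S R x"
      using N_normal_normalisation_of[OF assms(4,5) x(1)] y by (auto simp: N_normal_def)
    then obtain x' where "(x, x') \<in> R"
      using R_normal_length_2[OF assms(2) x] by blast
    then show ?thesis
      using rule y by simp
  qed
  moreover have "(x, y) \<in> rewriting_of S (normalisation_of S R)" if "(x, y) \<in> R" for x y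
    using that assms(1,2,6) rule[OF that]
    by (auto simp: rewriting_of_iff rewriting_system_def quadratic_rules_def irrefl_def)
  ultimately show ?thesis
    by (intro equalityI subrelI)
qed

theorem proposition3p2p1:
  fixes S :: "'a set" and M :: "('b, 'm) monoid_scheme"
  assumes "monoid M"
  shows
    "(\<forall>N. quadratic_normalisation S N \<and> normalisation_for S N M \<longrightarrow>
        rewriting_system S (rewriting_of S N) \<and> quadratic_rules (rewriting_of S N) \<and>
        reduced S (rewriting_of S N) \<and> normalising S (rewriting_of S N) \<and>
        confluent S (rewriting_of S N) \<and> presented_by M S (rewriting_of S N))
     \<and>
     (\<forall>R. rewriting_system S R \<and> quadratic_rules R \<and> reduced S R \<and> normalising S R \<and>
        confluent S R \<and> presented_by M S R \<longrightarrow>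
        quadratic_normalisation S (normalisation_of S R) \<and>
        normalisation_for S (normalisation_of S R) M)
     \<and>
     (\<forall>N. quadratic_normalisation S N \<and> normalisation_for S N M \<longrightarrow>
        normalisation_of S (rewriting_of S N) = N)
     \<and>
     (\<forall>R. rewriting_system S R \<and> quadratic_rules R \<and> reduced S R \<and> normalising S R \<and>
        confluent S R \<and> presented_by M S R \<and> irrefl R \<longrightarrow>
        rewriting_of S (normalisation_of S R) = R)"
proof (intro conjI)
  show "\<forall>N. quadratic_normalisation S N \<and> normalisation_for S N M \<longrightarrow>
      rewriting_system S (rewriting_of S N) \<and> quadratic_rules (rewriting_of S N) \<and>
      reduced S (rewriting_of S N) \<and> normalising S (rewriting_of S N) \<and>
      confluent S (rewriting_of S N) \<and> presented_by M S (rewriting_of S N)"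
    by (simp add: normalisation_for_def rewriting_system_rewriting_of
        quadratic_rules_rewriting_of reduced_rewriting_of normalising_rewriting_of
        confluent_rewriting_of presented_by_rewriting_of)
  show "\<forall>R. rewriting_system S R \<and> quadratic_rules R \<and> reduced S R \<and> normalising S R \<and>
      confluent S R \<and> presented_by M S R \<longrightarrow>
      quadratic_normalisation S (normalisation_of S R) \<and>
      normalisation_for S (normalisation_of S R) M"
    by (simp add: normalisation_for_def quadratic_normalisation_normalisation_of
        normalisation_normalisation_of presented_by_normalisation_of)
  show "\<forall>N. quadratic_normalisation S N \<and> normalisation_for S N M \<longrightarrow>
      normalisation_of S (rewriting_of S N) = N"
    by (simp add: normalisation_of_rewriting_of)
  show "\<forall>R. rewriting_system S R \<and> quadratic_rules R \<and> reduced S R \<and> normalising S R \<and>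
      confluent S R \<and> presented_by M S R \<and> irrefl R \<longrightarrow>
      rewriting_of S (normalisation_of S R) = R"
    by (simp add: rewriting_of_normalisation_of)
qed

end
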